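(* Let $T\in\mathcal{K}(V)$ be bisectorial of angle $\omega\in(0,\frac{\pi}{2})$, let $\theta\in(\omega,\frac{\pi}{2})$ and $g\in\mathcal{N}^0(D_\theta)$. With the $\omega$-functional calculus of $T$: i) For every $B\in\mathcal{B}(V)$ with $TB\supseteq BT$, one has $Bg(T)=g(T)B$. ii) For every intrinsic polynomial $p$, one has $p[T]g(T)\supseteq g(T)p[T]$. iii) For every $f\in\mathcal{N}^0(D_\theta)$, one has $g(T)f(T)=f(T)g(T)$.
   Context: Clifford setting. Fix an integer $n\geq 1$. $\mathbb{R}_n$ is the real Clifford algebra generated by $e_1,\dots,e_n$ with $e_i^2=-1$, $e_ie_j=-e_je_i$ ($i\neq j$), with basis $e_A=e_{i_1}\cdots e_{i_r}$ for $A=(i_1<\dots<i_r)$, $e_\emptyset=1$, and $|s|^2=\sum_As_A^2$ for $s=\sum_As_Ae_A$. Paravectors: $\mathbb{R}^{n+1}=\{s_0+s_1e_1+\dots+s_ne_n\}\subseteq\mathbb{R}_n$ with $\overline{s}=s_0-s_1e_1-\dots-s_ne_n$. $\mathbb{S}=\{s\in\mathbb{R}^{n+1}: s_0=0,|s|=1\}$ and $\mathbb{C}_J=\{x+Jy: x,y\in\mathbb{R}\}$ for $J\in\mathbb{S}$. $U\subseteq\mathbb{R}^{n+1}$ is axially symmetric if $x+Jy\in U$ ($x,y\in\mathbb{R}$, $J\in\mathbb{S}$) implies $x+Iy\in U$ for all $I\in\mathbb{S}$. Slice hyperholomorphic functions. For $U$ open and axially symmetric, $f:U\to\mathbb{R}_n$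 is left slice hyperholomorphic ($f\in\mathcal{SH}_L(U)$) if there are continuously differentiable $f_0,f_1:\{(x,y)\in\mathbb{R}^2: x+\mathbb{S}y\subseteq U\}\to\mathbb{R}_n$ with $f(x+Jy)=f_0(x,y)+Jf_1(x,y)$ for all $J\in\mathbb{S}$, $f_0(x,-y)=f_0(x,y)$, $f_1(x,-y)=-f_1(x,y)$, $\partial_xf_0=\partial_yf_1$, $\partial_yf_0=-\partial_xf_1$. If $f_0,f_1$ are real valued, $f$ is called intrinsic ($f\in\mathcal{N}(U)$). Operators. $V_\mathbb{R}$ is a real Banach space, $V=\{\sum_Av_A\otimes e_A: v_A\in V_\mathbb{R}\}$ the corresponding Clifford module with norm $\|v\|^2=\sum_A\|v_A\|^2$ and the natural left and right multiplications by $\mathbb{R}_n$. $\mathcal{B}(V)$: bounded everywhere defined right-linear operators; $\mathcal{K}(V)$: closed right-linear operators $T:\operatorname{dom}(T)\to V$ with right-linear domain $\operatorname{dom}(T)\subseteq V$. A Clifford number $a$ is identified with the operator $v\mapsto av$, so $(aT)v=a(Tv)$, $(Ta)v=T(av)$. For operators, $A\subseteq B$ means $\operatorname{dom}(A)\subseteq\operatorname{dom}(B)$ and $Av=Bv$ for $v\in\operatorname{dom}(A)$; products have their natural domains. For $s\in\mathbb{R}^{n+1}$, $Q_s[T]=T^2-2s_0T+|s|^2$ on $\operatorname{dom}(T^2)$; $\rho_S(T)=\{s\in\mathbb{R}^{n+1}: Q_s[T]^{-1}\in\mathcal{B}(V)\}$, $\sigma_S(T)=\mathbb{R}^{n+1}\setminus\rho_S(T)$,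 and $S_L^{-1}(s,T)=Q_s[T]^{-1}\overline{s}-TQ_s[T]^{-1}$ for $s\in\rho_S(T)$. Bisectorial operators. For $\omega\in(0,\frac{\pi}{2})$, $I_\omega=(-\omega,\omega)\cup(\pi-\omega,\pi+\omega)$ and $D_\omega=\{re^{J\phi}: r>0,\,J\in\mathbb{S},\,\phi\in I_\omega\}\subseteq\mathbb{R}^{n+1}$. $T\in\mathcal{K}(V)$ is bisectorial of angle $\omega$ if $\sigma_S(T)\subseteq\overline{D_\omega}$ and for every $\varphi\in(\omega,\frac{\pi}{2})$ there is $C_\varphi\geq 0$ with $\|S_L^{-1}(s,T)\|\leq\frac{C_\varphi}{|s|}$ for all $s\in\mathbb{R}^{n+1}\setminus(D_\varphi\cup\{0\})$. $\omega$-functional calculus. $\mathcal{SH}_L^0(D_\theta)$ is the set of bounded $f\in\mathcal{SH}_L(D_\theta)$ with $\int_0^\infty|f(te^{J\phi})|\frac{dt}{t}<\infty$ for all $J\in\mathbb{S}$, $\phi\in I_\theta$; $\mathcal{N}^0(D_\theta)$ is the set of intrinsic such functions. For $T$ bisectorial of angle $\omega$, $\theta\in(\omega,\frac{\pi}{2})$ and $f\in\mathcal{SH}_L^0(D_\theta)$, $$f(T)=\frac{1}{2\pi}\int_{\partial D_\varphi\cap\mathbb{C}_J}S_L^{-1}(s,T)ds_Jf(s):=\frac{1}{2\pi}\sum_\pm\int_\mathbb{R}S_L^{-1}(\gamma_\pm(t),T)\frac{\gamma_\pm'(t)}{J}f(\gamma_\pm(t))dt\in\mathcal{B}(V),$$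 with $\gamma_\pm(t)=\pm|t|e^{-\operatorname{sgn}(t)J\varphi}$; it does not depend on the choice of $\varphi\in(\omega,\theta)$ and $J\in\mathbb{S}$. Polynomials. An intrinsic polynomial of degree $m$ is $p(s)=p_0+p_1s+\dots+p_ms^m$ with real coefficients, $p_m\neq 0$; $p[T]=p_0+p_1T+\dots+p_mT^m$ with $\operatorname{dom}(p[T])=\operatorname{dom}(T^m)$. *)

theory Defs
  imports "HOL-Analysis.Analysis" "HOL-Computational_Algebra.Polynomial"
begin

section \<open>The Clifford algebra and Clifford modules\<close>

text \<open>
  The generators \<open>e\<^sub>i\<close> are indexed by a finite linearly ordered type \<open>'n\<close>, so \<open>n = CARD('n) \<ge> 1\<close> is
  arbitrary. An element of the module \<open>V\<close> over \<open>\<real>\<^sub>n\<close> is the vector of its components \<open>v\<^sub>A\<close>, where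
  \<open>A\<close> ranges over all subsets of the index set; the Clifford algebra is the case \<open>V\<^sub>\<real> = \<real>\<close>.
  The library norm of \<open>'v ^ 'n set\<close> is \<open>\<parallel>v\<parallel>\<^sup>2 = \<Sum>\<^sub>A \<parallel>v\<^sub>A\<parallel>\<^sup>2\<close>. The library operations \<open>*\<close> and \<open>1\<close>
  on this type are componentwise and are \<^emph>\<open>not\<close> the Clifford ones; they are never used below.
\<close>

type_synonym ('v, 'n) cl_module = "'v ^ 'n set"
type_synonym 'n clifford = "(real, 'n) cl_module"

text \<open>
  \<open>e\<^sub>A e\<^sub>B = blade_sign A B \<cdot> e\<^bsub>A \<triangle> B\<^esub>\<close>: the pairs \<open>j < i\<close> count the transpositions that sort the
  product, the pairs \<open>j = i\<close> the contractions \<open>e\<^sub>i\<^sup>2 = -1\<close>.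
\<close>

definition blade_sign :: "'n::{finite,linorder} set \<Rightarrow> 'n set \<Rightarrow> real" where
  "blade_sign A B = (- 1) ^ card {(i, j). i \<in> A \<and> j \<in> B \<and> j \<le> i}"

definition lmul :: "'n::{finite,linorder} clifford \<Rightarrow> ('v::real_vector, 'n) cl_module \<Rightarrow> ('v, 'n) cl_module"
  where "lmul a v =
    (\<Sum>A\<in>UNIV. \<Sum>B\<in>UNIV. axis (sym_diff A B) ((blade_sign A B * a $ A) *\<^sub>R (v $ B)))"

definition rmul :: "('v::real_vector, 'n::{finite,linorder}) cl_module \<Rightarrow> 'n clifford \<Rightarrow> ('v, 'n) cl_module"
  where "rmul v a =
    (\<Sum>B\<in>UNIV. \<Sum>A\<in>UNIV. axis (sym_diff B A) ((blade_sign B A * a $ A) *\<^sub>R (v $ B)))"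

abbreviation cl_mul :: "'n::{finite,linorder} clifford \<Rightarrow> 'n clifford \<Rightarrow> 'n clifford" where
  "cl_mul \<equiv> lmul"

definition cl_real :: "real \<Rightarrow> 'n::{finite,linorder} clifford" where
  "cl_real r = axis {} r"

definition blade :: "'n::{finite,linorder} set \<Rightarrow> 'n clifford" where
  "blade A = axis A 1"

lemma cl_mul_blade: "cl_mul (blade A) (blade B) = blade_sign A B *\<^sub>R blade (sym_diff A B)"
proof -
  have 1: "(\<Sum>B'\<in>UNIV. axis (sym_diff A' B') ((blade_sign A' B' * blade A $ A') *\<^sub>R (blade B $ B')))
      = axis (sym_diff A' B) (blade_sign A' B * blade A $ A')" for A'
    by (subst sum.remove[of _ B]) (auto simp: blade_def axis_def vec_eq_iff intro!: sum.neutral)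
  show ?thesis
    unfolding lmul_def 1
    by (subst sum.remove[of _ A]) (auto simp: blade_def axis_def vec_eq_iff intro!: sum.neutral)
qed

lemma generator_square: "cl_mul (blade {i}) (blade {i}) = cl_real (- 1)"
proof -
  have "{(k, j). k \<in> {i} \<and> j \<in> {i} \<and> j \<le> k} = {(i, i)}"
    by auto
  then show ?thesis
    unfolding cl_mul_blade by (simp add: blade_sign_def blade_def cl_real_def axis_def vec_eq_iff)
qed

lemma generator_anticommute:
  assumes "i \<noteq> j"
  shows "cl_mul (blade {i}) (blade {j}) = - cl_mul (blade {j}) (blade {i})"
proof -
  have "{(k, l). k \<in> {i} \<and> l \<in> {j} \<and> l \<le> k} = (if j \<le> i then {(i, j)} else {})" for i j :: 'a
    by auto
  then show ?thesis
    using assms unfolding cl_mul_blade by (auto simp: blade_sign_def Un_commute)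
qed

lemma blade_ordered_product:
  assumes "\<And>j. j \<in> A \<Longrightarrow> i < j"
  shows "blade (insert i A) = cl_mul (blade {i}) (blade A)"
proof -
  have *: "{(k, j). k \<in> {i} \<and> j \<in> A \<and> j \<le> k} = {}" "sym_diff {i} A = insert i A"
    using assms by force+
  show ?thesis
    unfolding cl_mul_blade blade_sign_def * by simp
qed


section \<open>Paravectors and slice hyperholomorphic functions\<close>

definition paravectors :: "'n::{finite,linorder} clifford set" where
  "paravectors = {s. \<forall>A. card A > 1 \<longrightarrow> s $ A = 0}"

text \<open>Used on paravectors only, where it is the Clifford conjugation.\<close>

definition cl_conj :: "'n::{finite,linorder} clifford \<Rightarrow> 'n clifford" where
  "cl_conj s = (\<chi> A. if A = {} then s $ A else - s $ A)"

definition imag_units :: "'n::{finite,linorder} clifford set" where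
  "imag_units = {s \<in> paravectors. s $ {} = 0 \<and> norm s = 1}"

text \<open>The point \<open>x + J y\<close>.\<close>

definition slice_pt :: "real \<Rightarrow> 'n::{finite,linorder} clifford \<Rightarrow> real \<Rightarrow> 'n clifford" where
  "slice_pt x J y = cl_real x + y *\<^sub>R J"

definition cl_exp :: "'n::{finite,linorder} clifford \<Rightarrow> real \<Rightarrow> 'n clifford" where
  "cl_exp J \<phi> = slice_pt (cos \<phi>) J (sin \<phi>)"

definition axially_symmetric :: "'n::{finite,linorder} clifford set \<Rightarrow> bool" where
  "axially_symmetric U \<longleftrightarrow> U \<subseteq> paravectors \<and>
    (\<forall>x y. \<forall>J\<in>imag_units. slice_pt x J y \<in> U \<longrightarrow> (\<forall>I\<in>imag_units. slice_pt x I y \<in> U))"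

definition slice_coords :: "'n::{finite,linorder} clifford set \<Rightarrow> (real \<times> real) set" where
  "slice_coords U = {(x, y). \<forall>J\<in>imag_units. slice_pt x J y \<in> U}"

text \<open>
  The components \<open>f\<^sub>0, f\<^sub>1\<close> of a left slice hyperholomorphic function: \<open>f0'\<close> and \<open>f1'\<close> are their
  total derivatives, so that the values at \<open>(1, 0)\<close> and \<open>(0, 1)\<close> are the partial derivatives.
\<close>

definition slice_components ::
  "'n::{finite,linorder} clifford set \<Rightarrow> ('n clifford \<Rightarrow> 'n clifford) \<Rightarrow>
   (real \<times> real \<Rightarrow> 'n clifford) \<Rightarrow> (real \<times> real \<Rightarrow> 'n clifford) \<Rightarrow> bool" where
  "slice_components U f f0 f1 \<longleftrightarrow>
    (\<forall>(x, y)\<in>slice_coords U.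
       (\<forall>J\<in>imag_units. f (slice_pt x J y) = f0 (x, y) + cl_mul J (f1 (x, y))) \<and>
       f0 (x, - y) = f0 (x, y) \<and> f1 (x, - y) = - f1 (x, y)) \<and>
    (\<exists>f0' f1' :: real \<times> real \<Rightarrow> (real \<times> real) \<Rightarrow>\<^sub>L 'n clifford.
       continuous_on (slice_coords U) f0' \<and> continuous_on (slice_coords U) f1' \<and>
       (\<forall>z\<in>slice_coords U.
          (f0 has_derivative blinfun_apply (f0' z)) (at z) \<and>
          (f1 has_derivative blinfun_apply (f1' z)) (at z) \<and>
          f0' z (1, 0) = f1' z (0, 1) \<and>
          f0' z (0, 1) = - f1' z (1, 0)))"

definition SH_L :: "'n::{finite,linorder} clifford set \<Rightarrow> ('n clifford \<Rightarrow> 'n clifford) set" where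
  "SH_L U = {f. openin (top_of_set paravectors) U \<and> axially_symmetric U \<and>
     (\<exists>f0 f1. slice_components U f f0 f1)}"

definition intrinsic :: "'n::{finite,linorder} clifford set \<Rightarrow> ('n clifford \<Rightarrow> 'n clifford) set" where
  "intrinsic U = {f. openin (top_of_set paravectors) U \<and> axially_symmetric U \<and>
     (\<exists>f0 f1. slice_components U f f0 f1 \<and>
        (\<forall>z\<in>slice_coords U. f0 z \<in> range cl_real \<and> f1 z \<in> range cl_real))}"


section \<open>Operators\<close>

text \<open>
  An operator with domain is a partial map. With \<open>\<circ>\<^sub>m\<close> products have their natural domain, and
  \<open>A \<subseteq>\<^sub>m B\<close> says \<open>dom A \<subseteq> dom B\<close> and \<open>A v = B v\<close> for \<open>v \<in> dom A\<close>.
\<close>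

type_synonym ('v, 'n) cl_op = "('v, 'n) cl_module \<rightharpoonup> ('v, 'n) cl_module"

abbreviation total_op :: "('a \<Rightarrow> 'a) \<Rightarrow> 'a \<rightharpoonup> 'a" where
  "total_op B \<equiv> (\<lambda>v. Some (B v))"

definition op_diff :: "('a::minus \<rightharpoonup> 'a) \<Rightarrow> ('a \<rightharpoonup> 'a) \<Rightarrow> 'a \<rightharpoonup> 'a" where
  "op_diff A B = (\<lambda>v. if v \<in> dom A \<inter> dom B then Some (the (A v) - the (B v)) else None)"

text \<open>For a linear operator that is not injective the result is the empty map.\<close>

definition op_inv :: "('a \<rightharpoonup> 'a) \<Rightarrow> 'a \<rightharpoonup> 'a" where
  "op_inv A = (\<lambda>w. if \<exists>!v. A v = Some w then Some (THE v. A v = Some w) else None)"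

definition op_pow :: "('a \<rightharpoonup> 'a) \<Rightarrow> nat \<Rightarrow> 'a \<rightharpoonup> 'a" where
  "op_pow A k = (((\<lambda>X. A \<circ>\<^sub>m X) ^^ k) Some)"

text \<open>\<open>p[T] = p\<^sub>0 + p\<^sub>1 T + \<dots> + p\<^sub>m T\<^sup>m\<close> with domain \<open>dom (T\<^sup>m)\<close>, \<open>m\<close> the degree of \<open>p\<close>.\<close>

definition poly_op :: "real poly \<Rightarrow> ('a::real_vector \<rightharpoonup> 'a) \<Rightarrow> 'a \<rightharpoonup> 'a" where
  "poly_op p T = (\<lambda>v. if v \<in> dom (op_pow T (degree p))
     then Some (\<Sum>k\<le>degree p. coeff p k *\<^sub>R the (op_pow T k v)) else None)"

definition op_norm_le :: "('a::real_normed_vector \<rightharpoonup> 'a) \<Rightarrow> real \<Rightarrow> bool" where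
  "op_norm_le A c \<longleftrightarrow> dom A = UNIV \<and> (\<forall>v. norm (the (A v)) \<le> c * norm v)"

definition bounded_ops ::
  "(('v::real_normed_vector, 'n::{finite,linorder}) cl_module \<Rightarrow>\<^sub>L ('v, 'n) cl_module) set" where
  "bounded_ops = {B. \<forall>v a. blinfun_apply B (rmul v a) = rmul (blinfun_apply B v) a}"

definition closed_ops :: "('v::real_normed_vector, 'n::{finite,linorder}) cl_op set" where
  "closed_ops = {T. 0 \<in> dom T \<and>
     (\<forall>v w x y. T v = Some x \<longrightarrow> T w = Some y \<longrightarrow> T (v + w) = Some (x + y)) \<and>
     (\<forall>v x a. T v = Some x \<longrightarrow> T (rmul v a) = Some (rmul x a)) \<and>
     closed {(v, x). T v = Some x}}"

definition Q_op ::
  "'n::{finite,linorder} clifford \<Rightarrow> ('v::real_normed_vector, 'n) cl_op \<Rightarrow> ('v, 'n) cl_op" where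
  "Q_op s T = poly_op [:(norm s)\<^sup>2, - 2 * s $ {}, 1:] T"

definition S_resolvent_set ::
  "('v::real_normed_vector, 'n::{finite,linorder}) cl_op \<Rightarrow> 'n clifford set" where
  "S_resolvent_set T = {s \<in> paravectors. \<exists>B\<in>bounded_ops. op_inv (Q_op s T) = total_op (blinfun_apply B)}"

definition S_spectrum ::
  "('v::real_normed_vector, 'n::{finite,linorder}) cl_op \<Rightarrow> 'n clifford set" where
  "S_spectrum T = paravectors - S_resolvent_set T"

definition S_L_inv ::
  "'n::{finite,linorder} clifford \<Rightarrow> ('v::real_normed_vector, 'n) cl_op \<Rightarrow> ('v, 'n) cl_op" where
  "S_L_inv s T = op_diff (op_inv (Q_op s T) \<circ>\<^sub>m total_op (lmul (cl_conj s))) (T \<circ>\<^sub>m op_inv (Q_op s T))"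


section \<open>Bisectorial operators and the functional calculus\<close>

definition arg_range :: "real \<Rightarrow> real set" where
  "arg_range \<omega> = {- \<omega> <..< \<omega>} \<union> {pi - \<omega> <..< pi + \<omega>}"

definition double_sector :: "real \<Rightarrow> 'n::{finite,linorder} clifford set" where
  "double_sector \<omega> = {r *\<^sub>R cl_exp J \<phi> | r J \<phi>. r > 0 \<and> J \<in> imag_units \<and> \<phi> \<in> arg_range \<omega>}"

definition bisectorial :: "real \<Rightarrow> ('v::real_normed_vector, 'n::{finite,linorder}) cl_op \<Rightarrow> bool" where
  "bisectorial \<omega> T \<longleftrightarrow>
    T \<in> closed_ops \<and>
    S_spectrum T \<subseteq> closure (double_sector \<omega>) \<and>
    (\<forall>\<phi>\<in>{\<omega> <..< pi / 2}. \<exists>C\<ge>0. \<forall>s\<in>paravectors - (double_sector \<phi> \<union> {0}).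
       op_norm_le (S_L_inv s T) (C / norm s))"

definition SH_L0 :: "real \<Rightarrow> ('n::{finite,linorder} clifford \<Rightarrow> 'n clifford) set" where
  "SH_L0 \<theta> = {f \<in> SH_L (double_sector \<theta>).
     bounded (f ` double_sector \<theta>) \<and>
     (\<forall>J\<in>imag_units. \<forall>\<phi>\<in>arg_range \<theta>.
        (\<integral>\<^sup>+t\<in>{0<..}. ennreal (norm (f (t *\<^sub>R cl_exp J \<phi>)) / t) \<partial>lborel) < \<infinity>)}"

definition intrinsic0 :: "real \<Rightarrow> ('n::{finite,linorder} clifford \<Rightarrow> 'n clifford) set" where
  "intrinsic0 \<theta> = SH_L0 \<theta> \<inter> intrinsic (double_sector \<theta>)"

definition bisector_path ::
  "real \<Rightarrow> 'n::{finite,linorder} clifford \<Rightarrow> real \<Rightarrow> real \<Rightarrow> 'n clifford" where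
  "bisector_path \<phi> J \<sigma> t = (\<sigma> * \<bar>t\<bar>) *\<^sub>R cl_exp J (- sgn t * \<phi>)"

text \<open>
  The integrand \<open>S\<^sub>L\<^sup>-\<^sup>1(\<gamma>(t), T) \<gamma>'(t)/J f(\<gamma>(t))\<close>, where \<open>1/J = -J\<close>. It is an everywhere defined
  bounded operator for \<open>t \<noteq> 0\<close> in the situation considered; the value at \<open>t = 0\<close> is irrelevant.
\<close>

definition omega_integrand ::
  "real \<Rightarrow> 'n::{finite,linorder} clifford \<Rightarrow> ('v::real_normed_vector, 'n) cl_op \<Rightarrow>
   ('n clifford \<Rightarrow> 'n clifford) \<Rightarrow> real \<Rightarrow> real \<Rightarrow> ('v, 'n) cl_module \<Rightarrow>\<^sub>L ('v, 'n) cl_module" where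
  "omega_integrand \<phi> J T f \<sigma> t =
    (let \<gamma> = bisector_path \<phi> J \<sigma> in
     Blinfun (\<lambda>v. the ((S_L_inv (\<gamma> t) T \<circ>\<^sub>m
       total_op (lmul (cl_mul (cl_mul (vector_derivative \<gamma> (at t)) (- J)) (f (\<gamma> t))))) v)))"

text \<open>
  The operator \<open>f(T)\<close>, an integral with respect to the operator norm, computed with the angle
  \<open>\<phi>\<close> and the imaginary unit \<open>J\<close>. The gauge integral is used because the library's Bochner integral
  needs a separable target space; both agree where the latter is defined.
\<close>

definition omega_calculus ::
  "real \<Rightarrow> 'n::{finite,linorder} clifford \<Rightarrow> ('v::real_normed_vector, 'n) cl_op \<Rightarrow>
   ('n clifford \<Rightarrow> 'n clifford) \<Rightarrow> ('v, 'n) cl_module \<Rightarrow>\<^sub>L ('v, 'n) cl_module" where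
  "omega_calculus \<phi> J T f =
    (1 / (2 * pi)) *\<^sub>R (\<Sum>\<sigma>\<in>{1, - 1}. integral UNIV (omega_integrand \<phi> J T f \<sigma>))"

end

theory Submission
  imports Defs
begin

text \<open>
  Call a bounded operator intrinsic for \<open>T\<close> if it is right linear, preserves the graph of \<open>T\<close>, and
  commutes with every bounded right-linear operator that preserves this graph. Such operators form a
  closed real subspace \<open>M\<close>, which contains \<open>Q\<^sub>s[T]\<^sup>-\<^sup>1\<close> and \<open>T Q\<^sub>s[T]\<^sup>-\<^sup>1\<close>. The values of the integrand of
  \<open>g(T)\<close> at \<open>t\<close> and \<open>-t\<close> add up to a real combination of these two operators, so \<open>g(T) \<in> M\<close>,
  which contains i) and ii). For iii), \<open>f(T) \<in> M\<close> is itself an admissible \<open>B\<close> in i), so that no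
  independence of the contour is needed. No integrability is needed either: a gauge integral over
  the line that does not exist is \<open>0\<close>, which also lies in \<open>M\<close>.
\<close>

section \<open>Clifford multiplication\<close>

lemma blade_sign_eq_prod:
  "blade_sign A B = (\<Prod>i\<in>A. \<Prod>j\<in>B. if j \<le> i then - 1 else 1)"
proof -
  have "{(i, j). i \<in> A \<and> j \<in> B \<and> j \<le> i} = (SIGMA i:A. {j\<in>B. j \<le> i})"
    by auto
  then have "card {(i, j). i \<in> A \<and> j \<in> B \<and> j \<le> i} = (\<Sum>i\<in>A. card {j\<in>B. j \<le> i})"
    by simp
  then show ?thesis
    unfolding blade_sign_def
    by (simp add: power_sum prod.If_cases Collect_conj_eq)
qed

text \<open>The factors indexed by the intersection occur twice on the right and cancel, because
  each squares to 1. Through \<open>blade_sign_eq_prod\<close> this makes \<open>blade_sign\<close>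
  multiplicative in each argument with respect to symmetric difference.\<close>

lemma prod_sym_diff_involutive:
  fixes f :: "'a \<Rightarrow> 'b::comm_monoid_mult"
  assumes "finite A" "finite B" "\<And>x. f x * f x = 1"
  shows "prod f (sym_diff A B) = prod f A * prod f B"
proof -
  have 1: "prod f A = prod f (A - B) * prod f (A \<inter> B)" "prod f B = prod f (B - A) * prod f (A \<inter> B)"
    using prod.Int_Diff[of A f B] prod.Int_Diff[of B f A] assms by (auto simp: Int_commute mult.commute)
  have "prod f (A \<inter> B) * prod f (A \<inter> B) = 1"
    by (simp add: assms flip: prod.distrib)
  moreover have "prod f (sym_diff A B) = prod f (A - B) * prod f (B - A)"
    by (rule prod.union_disjoint) (use assms in auto)
  moreover have "prod f A * prod f B = prod f (A - B) * prod f (B - A) * (prod f (A \<inter> B) * prod f (A \<inter> B))"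
    unfolding 1 by (simp add: ac_simps)
  ultimately show ?thesis
    by simp
qed

lemma blade_sign_sym_diff_left: "blade_sign (sym_diff A B) C = blade_sign A C * blade_sign B C"
  unfolding blade_sign_eq_prod
  by (rule prod_sym_diff_involutive) (auto simp flip: prod.distrib intro!: prod.neutral)

lemma blade_sign_sym_diff_right: "blade_sign A (sym_diff B C) = blade_sign A B * blade_sign A C"
  unfolding blade_sign_eq_prod prod.distrib[symmetric]
  by (intro prod.cong refl prod_sym_diff_involutive) auto

lemma blade_sign_empty [simp]: "blade_sign {} B = 1" "blade_sign A {} = 1"
  by (simp_all add: blade_sign_def)

lemma sym_diff_involutive: "sym_diff A (sym_diff A B) = B"
  by auto

section \<open>Clifford multiplication in coordinates\<close>

lemma lmul_nth:
  "lmul a v $ C = (\<Sum>A\<in>UNIV. (blade_sign A (sym_diff A C) * a $ A) *\<^sub>R (v $ sym_diff A C))"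
proof -
  have "(\<Sum>B\<in>UNIV. axis (sym_diff A B) ((blade_sign A B * a $ A) *\<^sub>R (v $ B)) $ C)
      = (blade_sign A (sym_diff A C) * a $ A) *\<^sub>R (v $ sym_diff A C)" for A
  proof -
    have "axis (sym_diff A B) ((blade_sign A B * a $ A) *\<^sub>R (v $ B)) $ C
      = (if B = sym_diff A C then (blade_sign A B * a $ A) *\<^sub>R (v $ B) else 0)" for B
      using sym_diff_involutive[of A B] sym_diff_involutive[of A C] by (auto simp: axis_def)
    then show ?thesis by simp
  qed
  then show ?thesis
    by (simp add: lmul_def)
qed

lemma rmul_nth:
  "rmul v a $ C = (\<Sum>A\<in>UNIV. (blade_sign (sym_diff A C) A * a $ A) *\<^sub>R (v $ sym_diff A C))"
proof -
  have "(\<Sum>B\<in>UNIV. axis (sym_diff B A) ((blade_sign B A * a $ A) *\<^sub>R (v $ B)) $ C)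
      = (blade_sign (sym_diff A C) A * a $ A) *\<^sub>R (v $ sym_diff A C)" for A
  proof -
    have "axis (sym_diff B A) ((blade_sign B A * a $ A) *\<^sub>R (v $ B)) $ C
      = (if B = sym_diff A C then (blade_sign B A * a $ A) *\<^sub>R (v $ B) else 0)" for B
      using sym_diff_involutive[of A B] sym_diff_involutive[of A C] by (auto simp: axis_def Un_commute)
    then show ?thesis by simp
  qed
  then show ?thesis
    unfolding rmul_def by (subst sum.swap) simp
qed

text \<open>In coordinates this is the 2-cocycle identity for \<open>blade_sign\<close>, after the
  index \<open>C\<close> of a blade of the product is replaced by the index
  \<open>B = sym_diff A C\<close> of a blade of \<open>b\<close>.\<close>

lemma lmul_assoc: "lmul (cl_mul a b) v = lmul a (lmul b v)"
proof (rule vec_eq_iff[THEN iffD2], rule allI)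
  fix D
  have "lmul (cl_mul a b) v $ D = (\<Sum>C\<in>UNIV. \<Sum>A\<in>UNIV. (blade_sign C (sym_diff C D) *
      blade_sign A (sym_diff A C) * a $ A * b $ sym_diff A C) *\<^sub>R (v $ sym_diff C D))"
    by (simp add: lmul_nth sum_distrib_left scaleR_sum_left mult.assoc)
  also have "\<dots> = (\<Sum>A\<in>UNIV. \<Sum>C\<in>UNIV. (blade_sign C (sym_diff C D) *
      blade_sign A (sym_diff A C) * a $ A * b $ sym_diff A C) *\<^sub>R (v $ sym_diff C D))"
    by (rule sum.swap)
  also have "\<dots> = (\<Sum>A\<in>UNIV. \<Sum>B\<in>UNIV. (blade_sign A (sym_diff A D) * a $ A *
      (blade_sign B (sym_diff B (sym_diff A D)) * b $ B)) *\<^sub>R (v $ sym_diff B (sym_diff A D)))"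
  proof (rule sum.cong[OF refl])
    fix A
    show "(\<Sum>C\<in>UNIV. (blade_sign C (sym_diff C D) *
      blade_sign A (sym_diff A C) * a $ A * b $ sym_diff A C) *\<^sub>R (v $ sym_diff C D))
      = (\<Sum>B\<in>UNIV. (blade_sign A (sym_diff A D) * a $ A *
      (blade_sign B (sym_diff B (sym_diff A D)) * b $ B)) *\<^sub>R (v $ sym_diff B (sym_diff A D)))"
    proof (rule sum.reindex_bij_witness[of _ "sym_diff A" "sym_diff A"])
      fix C
      have 1: "sym_diff (sym_diff A C) (sym_diff A D) = sym_diff C D"
        by auto
      \<comment> \<open>Bimultiplicativity expands both sides into the same elementary signs, except
        that \<open>blade_sign A D\<close> occurs twice on the left, where its square is 1.\<close>
      have 2: "blade_sign A (sym_diff A D) * blade_sign (sym_diff A C) (sym_diff C D)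
         = blade_sign C (sym_diff C D) * blade_sign A (sym_diff A C)"
        by (simp add: blade_sign_sym_diff_left blade_sign_sym_diff_right)
          (simp add: blade_sign_def flip: power_add)
      show "(blade_sign A (sym_diff A D) * a $ A * (blade_sign (sym_diff A C)
         (sym_diff (sym_diff A C) (sym_diff A D)) * b $ sym_diff A C)) *\<^sub>R
         (v $ sym_diff (sym_diff A C) (sym_diff A D)) =
        (blade_sign C (sym_diff C D) * blade_sign A (sym_diff A C) * a $ A * b $ sym_diff A C) *\<^sub>R
         (v $ sym_diff C D)"
        unfolding 1 2[symmetric] by (simp add: mult_ac)
    qed (auto)
  qed
  also have "\<dots> = lmul a (lmul b v) $ D"
    by (simp add: lmul_nth scaleR_sum_right)
  finally show "lmul (cl_mul a b) v $ D = lmul a (lmul b v) $ D" .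
qed

lemma bounded_linear_axis: "bounded_linear (axis k :: 'v::real_normed_vector \<Rightarrow> 'v ^ 'n::finite)"
proof (rule bounded_linear_intro[where K = 1])
  show "norm (axis k x :: 'v ^ 'n) \<le> norm x * 1" for x :: 'v
    using L2_set_le_sum[of UNIV "\<lambda>i. norm ((axis k x :: 'v ^ 'n) $ i)"]
    by (simp add: norm_vec_def axis_def if_distrib cong: if_cong)
qed (auto simp: axis_def vec_eq_iff)

lemma bounded_linear_lmul_right:
  "bounded_linear (lmul a :: ('v::real_normed_vector, 'n::{finite,linorder}) cl_module \<Rightarrow> _)"
  unfolding lmul_def
  by (intro bounded_linear_sum bounded_linear_compose[OF bounded_linear_axis]
      bounded_linear_const_scaleR bounded_linear_vec_nth)

lemma bounded_linear_rmul_left: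
  "bounded_linear (\<lambda>v :: ('v::real_normed_vector, 'n::{finite,linorder}) cl_module. rmul v a)"
  unfolding rmul_def
  by (intro bounded_linear_sum bounded_linear_compose[OF bounded_linear_axis]
      bounded_linear_const_scaleR bounded_linear_vec_nth)

lemma lmul_add_left: "lmul (a + b) v = lmul a v + lmul b v"
  by (simp add: vec_eq_iff lmul_nth algebra_simps scaleR_add_left sum.distrib)

lemma lmul_scaleR_left: "lmul (r *\<^sub>R a) v = r *\<^sub>R lmul a v"
  by (simp add: vec_eq_iff lmul_nth scaleR_sum_right algebra_simps)

lemma lmul_add_right: "lmul a (v + w) = lmul a v + lmul a w"
  by (simp add: vec_eq_iff lmul_nth algebra_simps sum.distrib)

lemma lmul_scaleR_right: "lmul a (r *\<^sub>R v) = r *\<^sub>R lmul a v"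
  by (simp add: vec_eq_iff lmul_nth scaleR_sum_right algebra_simps)

lemma rmul_add_left: "rmul (v + w) a = rmul v a + rmul w a"
  by (simp add: vec_eq_iff rmul_nth algebra_simps sum.distrib)

lemma rmul_scaleR_left: "rmul (r *\<^sub>R v) a = r *\<^sub>R rmul v a"
  by (simp add: vec_eq_iff rmul_nth scaleR_sum_right algebra_simps)

lemma lmul_sum_left: "lmul (sum f S) v = (\<Sum>i\<in>S. lmul (f i) v)"
  by (induction S rule: infinite_finite_induct)
    (simp_all add: lmul_add_left, simp_all add: vec_eq_iff lmul_nth)

lemma lmul_sum_right: "lmul a (sum f S) = (\<Sum>i\<in>S. lmul a (f i))"
  by (induction S rule: infinite_finite_induct)
    (simp_all add: lmul_add_right, simp_all add: vec_eq_iff lmul_nth)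

lemma lmul_cl_real:
  fixes v :: "('v::real_vector, 'n::{finite,linorder}) cl_module"
  shows "lmul (cl_real r) v = r *\<^sub>R v"
proof (rule vec_eq_iff[THEN iffD2], rule allI)
  fix C :: "'n set"
  have "lmul (cl_real r) v $ C = (\<Sum>A\<in>(UNIV :: 'n set set). if A = {} then r *\<^sub>R (v $ C) else 0)"
    unfolding lmul_nth by (intro sum.cong) (auto simp: cl_real_def axis_def)
  then show "lmul (cl_real r) v $ C = (r *\<^sub>R v) $ C"
    by simp
qed

lemma rmul_cl_real:
  fixes v :: "('v::real_vector, 'n::{finite,linorder}) cl_module"
  shows "rmul v (cl_real r) = r *\<^sub>R v"
proof (rule vec_eq_iff[THEN iffD2], rule allI)
  fix C :: "'n set"
  have "rmul v (cl_real r) $ C = (\<Sum>A\<in>(UNIV :: 'n set set). if A = {} then r *\<^sub>R (v $ C) else 0)"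
    unfolding rmul_nth by (intro sum.cong) (auto simp: cl_real_def axis_def)
  then show "rmul v (cl_real r) $ C = (r *\<^sub>R v) $ C"
    by simp
qed

lemma cl_mul_cl_real_right: "cl_mul a (cl_real r) = r *\<^sub>R a"
proof (rule vec_eq_iff[THEN iffD2], rule allI)
  fix C
  have "cl_mul a (cl_real r) $ C = (\<Sum>A\<in>UNIV. if A = C then r * a $ C else 0)"
    unfolding lmul_nth by (intro sum.cong) (auto simp: cl_real_def axis_def)
  then show "cl_mul a (cl_real r) $ C = (r *\<^sub>R a) $ C"
    by simp
qed

section \<open>Imaginary units and the slices spanned by 1 and \<open>J\<close>\<close>

lemma imag_unit_eq_sum:
  assumes "J \<in> imag_units"
  shows "J = (\<Sum>i\<in>UNIV. J $ {i} *\<^sub>R blade {i})"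
proof (rule vec_eq_iff[THEN iffD2], rule allI)
  fix A
  \<comment> \<open>The component at the empty set vanishes because the real part is zero, those at
    sets of two or more elements because \<open>J\<close> is a paravector.\<close>
  have "J $ A = 0" if "\<And>i. A \<noteq> {i}"
    using that assms by (cases "card A" "1 :: nat" rule: linorder_cases)
      (auto simp: imag_units_def paravectors_def card_1_singleton_iff)
  then show "J $ A = (\<Sum>i\<in>UNIV. J $ {i} *\<^sub>R blade {i}) $ A"
    by (cases "\<exists>i. A = {i}") (auto simp: blade_def axis_def if_distrib cong: if_cong)
qed

lemma imag_unit_sum_squares:
  assumes "J \<in> imag_units"
  shows "(\<Sum>i\<in>UNIV. (J $ {i})\<^sup>2) = 1"
proof -
  have "(\<Sum>i\<in>UNIV. (J $ {i})\<^sup>2) = (\<Sum>A\<in>range (\<lambda>i. {i}). (J $ A)\<^sup>2)"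
    by (simp add: sum.reindex)
  also have "\<dots> = (\<Sum>A\<in>UNIV. (J $ A)\<^sup>2)"
  proof (rule sum.mono_neutral_left)
    show "\<forall>A\<in>UNIV - range (\<lambda>i. {i}). (J $ A)\<^sup>2 = 0"
    proof
      fix A :: "'a set" assume "A \<in> UNIV - range (\<lambda>i. {i})"
      then show "(J $ A)\<^sup>2 = 0"
        using assms by (cases "card A" "1 :: nat" rule: linorder_cases)
          (auto simp: imag_units_def paravectors_def card_1_singleton_iff)
    qed
  qed auto
  also have "\<dots> = (norm J)\<^sup>2"
    by (simp add: norm_vec_def L2_set_def sum_nonneg)
  finally show ?thesis
    using assms by (simp add: imag_units_def)
qed

text \<open>Adding the double sum for the square to its copy with the two generators exchanged
  leaves only anticommutators. These vanish off the diagonal and equal -2 on it, and the squares of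
  the coordinates of \<open>J\<close> add up to 1.\<close>

lemma imag_unit_square:
  assumes "J \<in> imag_units"
  shows "cl_mul J J = cl_real (- 1)"
proof -
  let ?e = "\<lambda>i j. cl_mul (blade {i}) (blade {j})"
  have X: "cl_mul J J = (\<Sum>i\<in>UNIV. \<Sum>j\<in>UNIV. (J $ {i} * J $ {j}) *\<^sub>R ?e i j)"
    by (subst (1 2) imag_unit_eq_sum[OF assms])
      (subst sum.swap, simp add: lmul_sum_left lmul_sum_right lmul_scaleR_left lmul_scaleR_right
        scaleR_sum_right mult.commute)
  have e: "?e i j + ?e j i = (if i = j then cl_real (- 2) else 0)" for i j :: 'a
    using generator_anticommute[of i j]
    by (auto simp: generator_square cl_real_def axis_def vec_eq_iff)
  have "cl_mul J J + cl_mul J J =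
      (\<Sum>i\<in>UNIV. \<Sum>j\<in>UNIV. (J $ {i} * J $ {j}) *\<^sub>R ?e i j) +
      (\<Sum>i\<in>UNIV. \<Sum>j\<in>UNIV. (J $ {i} * J $ {j}) *\<^sub>R ?e j i)"
    unfolding X by (subst (4) sum.swap) (simp add: mult.commute)
  also have "\<dots> = (\<Sum>i\<in>UNIV. \<Sum>j\<in>UNIV. if j = i then (J $ {i})\<^sup>2 *\<^sub>R cl_real (- 2) else 0)"
    unfolding sum.distrib[symmetric] scaleR_add_right[symmetric] e
    by (intro sum.cong) (auto simp: power2_eq_square)
  also have "\<dots> = cl_real (- 2)"
    by (simp add: imag_unit_sum_squares[OF assms] flip: scaleR_sum_left)
  also have "\<dots> = cl_real (- 1) + cl_real (- 1)"
    by (simp add: cl_real_def axis_def vec_eq_iff)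
  finally have "2 *\<^sub>R cl_mul J J = 2 *\<^sub>R cl_real (- 1)"
    by (simp only: scaleR_2)
  then show ?thesis by simp
qed

lemma lmul_imag_unit_twice:
  assumes "J \<in> imag_units"
  shows "lmul J (lmul J v) = - v"
  using lmul_assoc[of J J v] imag_unit_square[OF assms] by (simp add: lmul_cl_real)

lemma lmul_slice_pt: "lmul (slice_pt x J y) v = x *\<^sub>R v + y *\<^sub>R lmul J v"
  by (simp add: slice_pt_def lmul_add_left lmul_scaleR_left lmul_cl_real)

text \<open>This is the cancellation that turns Clifford coefficients at conjugate points into real
  ones.\<close>

lemma lmul_slice_pt_add_conj:
  "lmul (slice_pt a J b) v + lmul (slice_pt a J (- b)) v = (2 * a) *\<^sub>R v"
  unfolding lmul_slice_pt mult_2 scaleR_add_left by simp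

text \<open>Since \<open>J\<close> squares to -1, a slice multiplies like the complex numbers. All
  coefficients along the contour lie in one slice and are computed by this rule.\<close>

lemma cl_mul_slice_pt:
  assumes "J \<in> imag_units"
  shows "cl_mul (slice_pt a J b) (slice_pt c J d) = slice_pt (a * c - b * d) J (a * d + b * c)"
proof -
  have "cl_mul J (slice_pt c J d) = slice_pt (- d) J c"
    by (simp add: slice_pt_def lmul_add_right lmul_scaleR_right cl_mul_cl_real_right
        imag_unit_square[OF assms]) (simp add: cl_real_def axis_def vec_eq_iff)
  then show ?thesis
    unfolding lmul_slice_pt
    by (simp add: slice_pt_def algebra_simps) (simp add: cl_real_def axis_def vec_eq_iff)
qed

lemma uminus_eq_slice_pt: "- J = slice_pt 0 J (- 1)"
  by (simp add: slice_pt_def cl_real_def axis_def vec_eq_iff)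

lemma slice_pt_nth_empty:
  assumes "J \<in> imag_units"
  shows "slice_pt x J y $ {} = x"
  using assms by (simp add: slice_pt_def cl_real_def imag_units_def)

lemma norm_slice_pt:
  assumes "J \<in> imag_units"
  shows "(norm (slice_pt x J y))\<^sup>2 = x\<^sup>2 + y\<^sup>2"
proof -
  have J: "J $ {} = 0" "norm J = 1"
    using assms by (auto simp: imag_units_def)
  have "(norm (slice_pt x J y))\<^sup>2 = (\<Sum>A\<in>UNIV. (slice_pt x J y $ A)\<^sup>2)"
    by (simp add: norm_vec_def L2_set_def sum_nonneg)
  also have "\<dots> = (\<Sum>A\<in>UNIV. (if A = {} then x\<^sup>2 else 0) + y\<^sup>2 * (J $ A)\<^sup>2)"
    using J by (intro sum.cong) (auto simp: slice_pt_def cl_real_def axis_def power_mult_distrib)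
  also have "\<dots> = x\<^sup>2 + y\<^sup>2 * (norm J)\<^sup>2"
    by (simp add: norm_vec_def L2_set_def sum_nonneg sum.distrib flip: sum_distrib_left)
  finally show ?thesis using J by simp
qed

lemma cl_conj_slice_pt:
  assumes "J \<in> imag_units"
  shows "cl_conj (slice_pt x J y) = slice_pt x J (- y)"
  using assms by (auto simp: vec_eq_iff cl_conj_def slice_pt_def cl_real_def axis_def imag_units_def)

lemma slice_pt_in_paravectors:
  assumes "J \<in> imag_units"
  shows "slice_pt x J y \<in> paravectors"
  using assms by (auto simp: paravectors_def slice_pt_def cl_real_def axis_def imag_units_def)

lemma scaleR_slice_pt: "r *\<^sub>R slice_pt x J y = slice_pt (r * x) J (r * y)"
  by (simp add: slice_pt_def cl_real_def axis_def vec_eq_iff algebra_simps)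

section \<open>Integrals with values in a closed subspace\<close>

text \<open>Riemann sums are linear combinations of values of the integrand, so they lie in the
  subspace, and the integral is a limit of such sums.\<close>

lemma has_integral_in_closed_subspace:
  fixes f :: "'a::euclidean_space \<Rightarrow> 'b::real_normed_vector"
  assumes f: "(f has_integral y) (cbox a b)" and S: "subspace S" "closed S"
    and neg: "negligible N" and in_S: "\<And>x. x \<notin> N \<Longrightarrow> f x \<in> S"
  shows "y \<in> S"
proof -
  \<comment> \<open>Resetting the integrand to 0 on the null set keeps the integral and places every
    value in \<open>S\<close>.\<close>
  let ?f = "\<lambda>x. if x \<in> N then 0 else f x"
  have "(?f has_integral y) (cbox a b)"
    by (rule has_integral_spike[OF neg _ f]) auto
  have f_in: "?f x \<in> S" for x
    using S(1) in_S by (auto simp: subspace_0)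
  have "\<exists>z\<in>S. dist z y < e" if "e > 0" for e
  proof -
    obtain \<gamma> where \<gamma>: "gauge \<gamma>"
      "\<forall>p. p tagged_division_of (cbox a b) \<and> \<gamma> fine p \<longrightarrow>
        norm ((\<Sum>(x, k)\<in>p. measure lborel k *\<^sub>R ?f x) - y) < e"
      using \<open>(?f has_integral y) (cbox a b)\<close>[unfolded has_integral, rule_format, OF \<open>e > 0\<close>] by (elim exE conjE)
    obtain p where p: "p tagged_division_of (cbox a b)" "\<gamma> fine p"
      using fine_division_exists[OF \<gamma>(1)] .
    have "(\<Sum>(x, k)\<in>p. measure lborel k *\<^sub>R ?f x) \<in> S"
      unfolding case_prod_beta by (intro subspace_sum subspace_scale S(1) f_in)
    then show ?thesis
      unfolding dist_norm using \<gamma>(2) p by (intro bexI) simp_all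
  qed
  then show ?thesis
    using closed_approachable[OF S(2)] by blast
qed

text \<open>Over a symmetric interval \<open>f\<close> and its reflection have the same integral, so
  twice this integral is the integral of an \<open>S\<close>-valued function. The integral over the
  line is a limit of these, and \<open>S\<close> is closed.\<close>

lemma integral_in_closed_subspace_reflect:
  fixes f :: "real \<Rightarrow> 'b::real_normed_vector"
  assumes S: "subspace S" "closed S"
    and in_S: "\<And>t. t \<noteq> 0 \<Longrightarrow> f t + f (- t) \<in> S"
  shows "integral UNIV f \<in> S"
proof (cases "f integrable_on UNIV")
  case False
  then show ?thesis
    using S(1) by (simp add: not_integrable_integral subspace_0)
next
  case True
  then have f: "(f has_integral integral UNIV f) UNIV"
    by (rule integrable_integral)
  have "\<exists>z\<in>S. dist z (integral UNIV f) < e" if "e > 0" for e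
  proof -
    obtain B where "B > 0" and
      B: "\<forall>a b. ball 0 B \<subseteq> cbox a b \<longrightarrow> (\<exists>z. ((\<lambda>x. if x \<in> UNIV then f x else 0) has_integral z) (cbox a b)
        \<and> norm (z - integral UNIV f) < e)"
      by (rule has_integral_altD[OF f _ \<open>e > 0\<close>]) auto
    have "ball 0 B \<subseteq> cbox (- B) B"
      by (auto simp: dist_norm)
    then obtain z where z: "(f has_integral z) (cbox (- B) B)" "norm (z - integral UNIV f) < e"
      using spec[OF spec[OF B, of "- B"], of B] by auto
    have "((\<lambda>t. f (- t)) has_integral z) (cbox (- B) B)"
      using z(1) has_integral_reflect[of f z B "- B"] by simp
    with z(1) have "((\<lambda>t. f t + f (- t)) has_integral (z + z)) (cbox (- B) B)"
      by (rule has_integral_add)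
    \<comment> \<open>The hypothesis says nothing about the point 0, which is removed as a null
      set.\<close>
    then have "z + z \<in> S"
      by (rule has_integral_in_closed_subspace[where N = "{0}"]) (use S in_S in auto)
    then have "(1 / 2) *\<^sub>R (z + z) \<in> S"
      by (rule subspace_scale[OF S(1)])
    then show ?thesis
      using z(2) by (auto simp: dist_norm simp flip: scaleR_2)
  qed
  then show ?thesis
    using closed_approachable[OF S(2)] by blast
qed

section \<open>Operators intrinsic for \<open>T\<close>\<close>

definition intrinsic_ops ::
  "('v::real_normed_vector, 'n::{finite,linorder}) cl_op \<Rightarrow> (('v, 'n) cl_module \<Rightarrow>\<^sub>L ('v, 'n) cl_module) set"
  where "intrinsic_ops T = {K \<in> bounded_ops.
    (\<forall>v x. T v = Some x \<longrightarrow> T (blinfun_apply K v) = Some (K x)) \<and>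
    (\<forall>B\<in>bounded_ops. (\<forall>v x. T v = Some x \<longrightarrow> T (blinfun_apply B v) = Some (B x)) \<longrightarrow> B o\<^sub>L K = K o\<^sub>L B)}"

text \<open>The graph form on the right is the one that passes easily to linear combinations and
  limits of \<open>B\<close>.\<close>

lemma total_op_comp_map_le_iff:
  "total_op B \<circ>\<^sub>m T \<subseteq>\<^sub>m T \<circ>\<^sub>m total_op B \<longleftrightarrow> (\<forall>v x. T v = Some x \<longrightarrow> T (B v) = Some (B x))"
  by (fastforce simp: map_le_def map_comp_def dom_def split: option.splits)

lemma closed_ops_0: "T \<in> closed_ops \<Longrightarrow> T 0 = Some 0"
proof -
  assume T: "T \<in> closed_ops"
  then obtain x where "T 0 = Some x" by (auto simp: closed_ops_def)
  \<comment> \<open>Right multiplication by the real number 0 sends whatever value \<open>T\<close>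
    has at 0 to 0.\<close>
  then have "T (rmul 0 (cl_real 0)) = Some (rmul x (cl_real 0))"
    using T by (simp only: closed_ops_def mem_Collect_eq)
  then show ?thesis by (simp add: rmul_cl_real)
qed

lemma closed_ops_add:
  "T \<in> closed_ops \<Longrightarrow> T v = Some x \<Longrightarrow> T w = Some y \<Longrightarrow> T (v + w) = Some (x + y)"
  by (simp add: closed_ops_def)

lemma closed_ops_rmul: "T \<in> closed_ops \<Longrightarrow> T v = Some x \<Longrightarrow> T (rmul v a) = Some (rmul x a)"
  by (simp add: closed_ops_def)

lemma closed_ops_scaleR: "T \<in> closed_ops \<Longrightarrow> T v = Some x \<Longrightarrow> T (r *\<^sub>R v) = Some (r *\<^sub>R x)"
  using closed_ops_rmul[of T v x "cl_real r"] by (simp add: rmul_cl_real)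

lemma closed_ops_diff:
  "T \<in> closed_ops \<Longrightarrow> T v = Some x \<Longrightarrow> T w = Some y \<Longrightarrow> T (v - w) = Some (x - y)"
  using closed_ops_add[of T v x "- w" "- y"] closed_ops_scaleR[of T w y "- 1"] by simp

lemma subspace_intrinsic_ops:
  assumes "T \<in> closed_ops"
  shows "subspace (intrinsic_ops T)"
proof (rule subspaceI)
  show "0 \<in> intrinsic_ops T"
    using closed_ops_0[OF assms]
    by (auto simp: intrinsic_ops_def bounded_ops_def blinfun_eqI rmul_nth vec_eq_iff)
next
  fix K L assume "K \<in> intrinsic_ops T" "L \<in> intrinsic_ops T"
  then show "K + L \<in> intrinsic_ops T"
    using closed_ops_add[OF assms]
    by (auto simp: intrinsic_ops_def bounded_ops_def blinfun.add_left rmul_add_left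
        bounded_bilinear.add_left[OF bounded_bilinear_blinfun_compose]
        bounded_bilinear.add_right[OF bounded_bilinear_blinfun_compose])
next
  fix r K assume "K \<in> intrinsic_ops T"
  then show "r *\<^sub>R K \<in> intrinsic_ops T"
    using closed_ops_scaleR[OF assms]
    by (auto simp: intrinsic_ops_def bounded_ops_def blinfun.scaleR_left rmul_scaleR_left
        bounded_bilinear.scaleR_left[OF bounded_bilinear_blinfun_compose]
        bounded_bilinear.scaleR_right[OF bounded_bilinear_blinfun_compose])
qed

text \<open>Right linearity and commutation are equations between continuous functions of
  \<open>K\<close>. Preservation of the graph is a closed condition because \<open>K v\<close> and
  \<open>K x\<close> depend continuously on \<open>K\<close> and the graph of \<open>T\<close> is
  closed.\<close>

lemma closed_intrinsic_ops:
  fixes T :: "('v::real_normed_vector, 'n::{finite,linorder}) cl_op"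
  assumes "T \<in> closed_ops"
  shows "closed (intrinsic_ops T)"
proof -
  have graph: "closed {(v, x). T v = Some x}"
    using assms by (simp add: closed_ops_def)
  have 0: "closed (bounded_ops :: (('v, 'n) cl_module \<Rightarrow>\<^sub>L ('v, 'n) cl_module) set)"
    unfolding bounded_ops_def
    by (intro closed_Collect_all closed_Collect_eq continuous_intros
        bounded_linear.continuous_on[OF bounded_linear_rmul_left])
  have "closed {K :: ('v, 'n) cl_module \<Rightarrow>\<^sub>L ('v, 'n) cl_module. T (K v) = Some (K x)}" for v x
    using closed_vimage[OF graph, of "\<lambda>K :: ('v, 'n) cl_module \<Rightarrow>\<^sub>L ('v, 'n) cl_module. (K v, K x)"]
    by (simp add: vimage_def continuous_intros)
  then have 1: "closed {K :: ('v, 'n) cl_module \<Rightarrow>\<^sub>L ('v, 'n) cl_module.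
      \<forall>v x. T v = Some x \<longrightarrow> T (K v) = Some (K x)}"
    by (intro closed_Collect_all closed_Collect_imp) auto
  have 2: "closed {K :: ('v, 'n) cl_module \<Rightarrow>\<^sub>L ('v, 'n) cl_module.
      \<forall>B\<in>bounded_ops. (\<forall>v x. T v = Some x \<longrightarrow> T (blinfun_apply B v) = Some (B x)) \<longrightarrow> B o\<^sub>L K = K o\<^sub>L B}"
    unfolding Ball_def
    by (intro closed_Collect_all closed_Collect_imp closed_Collect_eq open_Collect_const
        bounded_linear.continuous_on[OF bounded_bilinear.bounded_linear_left[OF bounded_bilinear_blinfun_compose]]
        bounded_linear.continuous_on[OF bounded_bilinear.bounded_linear_right[OF bounded_bilinear_blinfun_compose]]
        continuous_on_id)
  have "intrinsic_ops T = bounded_ops \<inter> ({K. \<forall>v x. T v = Some x \<longrightarrow> T (blinfun_apply K v) = Some (K x)} \<inter>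
      {K. \<forall>B\<in>bounded_ops. (\<forall>v x. T v = Some x \<longrightarrow> T (blinfun_apply B v) = Some (B x)) \<longrightarrow> B o\<^sub>L K = K o\<^sub>L B})"
    unfolding intrinsic_ops_def by (rule set_eqI) (simp only: mem_Collect_eq Int_iff)
  with closed_Int[OF 0 closed_Int[OF 1 2]] show ?thesis
    by (simp only:)
qed

section \<open>Powers and polynomials of \<open>T\<close>\<close>

lemma op_pow_0 [simp]: "op_pow T 0 = Some"
  by (simp add: op_pow_def)

lemma op_pow_Suc [simp]: "op_pow T (Suc k) = T \<circ>\<^sub>m op_pow T k"
  by (simp add: op_pow_def)

lemma op_pow_commute:
  assumes "\<And>v x. T v = Some x \<Longrightarrow> T (K v) = Some (K x)" and "op_pow T k v = Some x"
  shows "op_pow T k (K v) = Some (K x)"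
  using assms(2)
  by (induction k arbitrary: x) (auto simp: map_comp_def assms(1) split: option.splits)

lemma op_pow_domain_decreasing:
  "j \<le> k \<Longrightarrow> v \<in> dom (op_pow T k) \<Longrightarrow> v \<in> dom (op_pow T j)"
  by (induction k rule: dec_induct) (auto simp: map_comp_def dom_def split: option.splits)

text \<open>\<open>K\<close> carries the whole chain \<open>v\<close>, \<open>T v\<close>, and so on
  up to the degree of \<open>p\<close> to the chain of \<open>K v\<close>. This settles the domain
  as well as the value.\<close>

lemma poly_op_commute:
  assumes T: "\<And>v x. T v = Some x \<Longrightarrow> T (K v) = Some (K x)" and K: "linear K"
    and "poly_op p T v = Some x"
  shows "poly_op p T (K v) = Some (K x)"
proof -
  have v: "v \<in> dom (op_pow T (degree p))"
    and x: "x = (\<Sum>k\<le>degree p. coeff p k *\<^sub>R the (op_pow T k v))"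
    using assms(3) by (auto simp: poly_op_def split: if_splits)
  have pow: "op_pow T k (K v) = Some (K (the (op_pow T k v)))" if k: "k \<le> degree p" for k
  proof -
    obtain y where "op_pow T k v = Some y"
      using domD[OF op_pow_domain_decreasing[OF k v]] by (elim exE)
    with op_pow_commute[where T = T and K = K, OF T this] show ?thesis
      by simp
  qed
  have "K v \<in> dom (op_pow T (degree p))"
    using pow[of "degree p"] by (simp add: domI)
  moreover have "(\<Sum>k\<le>degree p. coeff p k *\<^sub>R the (op_pow T k (K v))) = K x"
    unfolding x linear_sum[OF K] linear_scale[OF K] by (intro sum.cong) (simp_all add: pow)
  ultimately show ?thesis
    by (simp add: poly_op_def)
qed

section \<open>The inverse of \<open>Q_op\<close> as an operator intrinsic for
  \<open>T\<close>\<close>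

lemma Q_op_slice_pt_eq_Some_iff:
  assumes "J \<in> imag_units"
  shows "Q_op (slice_pt x J y) T u = Some w \<longleftrightarrow>
    (\<exists>a b. T u = Some a \<and> T a = Some b \<and> w = (x\<^sup>2 + y\<^sup>2) *\<^sub>R u - (2 * x) *\<^sub>R a + b)"
proof -
  have deg: "degree [:(norm (slice_pt x J y))\<^sup>2, - 2 * slice_pt x J y $ {}, 1:] = Suc (Suc 0)"
    by simp
  show ?thesis
    unfolding Q_op_def poly_op_def deg
    by (auto simp: norm_slice_pt[OF assms] slice_pt_nth_empty[OF assms] map_comp_def
        split: option.splits)
qed

text \<open>
  The difference of \<open>S\<^sub>L\<^sup>-\<^sup>1(s, T)\<close> for conjugate \<open>s\<close> is \<open>Q\<^sub>s[T]\<^sup>-\<^sup>1\<close> composed with the invertible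
  \<open>-2 y J\<close>, so bounds on the former yield the boundedness of \<open>Q\<^sub>s[T]\<^sup>-\<^sup>1\<close>.
\<close>

lemma resolvent_in_intrinsic_ops:
  fixes T :: "('v::real_normed_vector, 'n::{finite,linorder}) cl_op"
  assumes T: "T \<in> closed_ops" and J: "J \<in> imag_units" and "y \<noteq> 0"
    and c: "op_norm_le (S_L_inv (slice_pt x J y) T) c"
    and c': "op_norm_le (S_L_inv (slice_pt x J (- y)) T) c'"
  obtains R P where "R \<in> intrinsic_ops T" "P \<in> intrinsic_ops T"
    "\<And>v. S_L_inv (slice_pt x J y) T v = Some (R (lmul (slice_pt x J (- y)) v) - P v)"
    "\<And>v. S_L_inv (slice_pt x J (- y)) T v = Some (R (lmul (slice_pt x J y) v) - P v)"
proof -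
  let ?s = "slice_pt x J y" and ?s' = "slice_pt x J (- y)"
  let ?m = "x\<^sup>2 + y\<^sup>2"
  define Q where "Q = Q_op ?s T"
  have Q_iff: "Q u = Some w \<longleftrightarrow>
      (\<exists>a b. T u = Some a \<and> T a = Some b \<and> w = ?m *\<^sub>R u - (2 * x) *\<^sub>R a + b)" for u w
    unfolding Q_def by (rule Q_op_slice_pt_eq_Some_iff[OF J])
  have "Q_op ?s' T u = Some w \<longleftrightarrow> Q u = Some w" for u w
    unfolding Q_iff Q_op_slice_pt_eq_Some_iff[OF J] by simp
  \<comment> \<open>Only the square of \<open>y\<close> enters, so conjugate points share one
    \<open>Q\<close> and hence the same \<open>R0\<close> and \<open>P0\<close>.\<close>
  then have Q': "Q_op ?s' T = Q"
    by (metis option.exhaust ext)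
  \<comment> \<open>That \<open>S_L_inv\<close> is defined everywhere means in particular that its
    second term is, so the inverse of \<open>Q\<close> is defined at every \<open>w\<close>.\<close>
  have ex1: "\<exists>!u. Q u = Some w" for w
  proof -
    have "w \<in> dom (S_L_inv ?s T)"
      using c by (simp add: op_norm_le_def)
    then have "op_inv Q w \<noteq> None"
      by (auto simp: S_L_inv_def op_diff_def Q_def map_comp_def split: if_splits option.splits)
    then show ?thesis
      by (auto simp: op_inv_def split: if_splits)
  qed
  define R0 where "R0 w = (THE u. Q u = Some w)" for w
  define P0 where "P0 w = the (T (R0 w))" for w
  have QR0: "Q (R0 w) = Some w" for w
    unfolding R0_def by (rule theI'[OF ex1])
  have op_inv_Q: "op_inv Q w = Some (R0 w)" for w
    using ex1 by (simp add: op_inv_def R0_def)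
  have TR0: "T (R0 w) = Some (P0 w)"
    and TP0: "T (P0 w) = Some (w - ?m *\<^sub>R R0 w + (2 * x) *\<^sub>R P0 w)" for w
    using QR0[of w] unfolding Q_iff P0_def by (auto simp: algebra_simps)
  \<comment> \<open>This uniqueness principle drives the algebra below: exhibiting a chain
    \<open>u\<close>, \<open>T u\<close>, \<open>T (T u)\<close> on which \<open>Q\<close> takes the
    value \<open>w\<close> identifies both \<open>R0 w\<close> and \<open>P0 w\<close>.\<close>
  have R0_eqI: "R0 w = u" and P0_eqI: "P0 w = a"
    if "T u = Some a" "T a = Some b" "w = ?m *\<^sub>R u - (2 * x) *\<^sub>R a + b" for u a b w
  proof -
    have "Q u = Some w" unfolding Q_iff using that by blast
    then show "R0 w = u" using ex1 QR0 by blast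
    then show "P0 w = a" using that TR0 by fastforce
  qed
  have add: "R0 (v + w) = R0 v + R0 w" "P0 (v + w) = P0 v + P0 w" for v w
    using R0_eqI[OF closed_ops_add[OF T TR0 TR0] closed_ops_add[OF T TP0 TP0], of "v + w" v w]
      P0_eqI[OF closed_ops_add[OF T TR0 TR0] closed_ops_add[OF T TP0 TP0], of "v + w" v w]
    by (simp_all add: algebra_simps)
  \<comment> \<open>A linear map preserving the graph sends the chain of \<open>w\<close> to the
    chain of \<open>L w\<close>. Real scaling and right multiplication are such maps, and so are the
    operators \<open>B\<close> in the definition of \<open>intrinsic_ops\<close>.\<close>
  have commute: "R0 (L w) = L (R0 w)" "P0 (L w) = L (P0 w)"
    if "linear L" and L: "\<And>v x. T v = Some x \<Longrightarrow> T (L v) = Some (L x)" for L w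
  proof -
    have "L w = ?m *\<^sub>R L (R0 w) - (2 * x) *\<^sub>R L (P0 w) + L (w - ?m *\<^sub>R R0 w + (2 * x) *\<^sub>R P0 w)"
      using \<open>linear L\<close> by (simp add: linear_add linear_diff linear_scale)
    then show "R0 (L w) = L (R0 w)" "P0 (L w) = L (P0 w)"
      using R0_eqI[OF L[OF TR0] L[OF TP0]] P0_eqI[OF L[OF TR0] L[OF TP0]] by blast+
  qed
  have scale: "R0 (r *\<^sub>R w) = r *\<^sub>R R0 w" "P0 (r *\<^sub>R w) = r *\<^sub>R P0 w" for r w
    using commute[OF linear_scaleR closed_ops_scaleR[OF T]] by auto
  have rmul: "R0 (rmul w a) = rmul (R0 w) a" "P0 (rmul w a) = rmul (P0 w) a" for w a
    using commute[OF bounded_linear.linear[OF bounded_linear_rmul_left] closed_ops_rmul[OF T]]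
    by auto
  have linear: "linear R0" "linear P0"
    by (auto intro!: linearI add scale)
  have S: "S_L_inv ?s T v = Some (R0 (lmul ?s' v) - P0 v)"
    and S': "S_L_inv ?s' T v = Some (R0 (lmul ?s v) - P0 v)" for v
    using op_inv_Q TR0
    by (simp_all add: S_L_inv_def cl_conj_slice_pt[OF J] op_diff_def Q' Q_def[symmetric] dom_def)
  have bS: "norm (R0 (lmul ?s' v) - P0 v) \<le> c * norm v"
    and bS': "norm (R0 (lmul ?s v) - P0 v) \<le> c' * norm v" for v
    using c c' S S' by (auto simp: op_norm_le_def dest: spec[of _ v])
  obtain KJ where KJ: "\<And>v :: ('v, 'n) cl_module. norm (lmul J v) \<le> norm v * KJ"
    using bounded_linear.bounded[OF bounded_linear_lmul_right] by blast
  have bR: "norm (R0 w) \<le> norm w * ((\<bar>c\<bar> + \<bar>c'\<bar>) * KJ / (2 * \<bar>y\<bar>))" for w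
  proof -
    \<comment> \<open>Inserting \<open>J w\<close> replaces the factor \<open>-2 y J\<close> by the
      real number \<open>2 y\<close>. In the difference of the two resolvents the \<open>P0\<close>
      terms cancel, so \<open>c\<close> and \<open>c'\<close> bound \<open>R0\<close>.\<close>
    have "lmul ?s' (lmul J w) - lmul ?s (lmul J w) = (2 * y) *\<^sub>R w"
      by (simp add: lmul_slice_pt lmul_imag_unit_twice[OF J] flip: scaleR_add_left)
    then have "(2 * y) *\<^sub>R R0 w = R0 (lmul ?s' (lmul J w)) - R0 (lmul ?s (lmul J w))"
      by (metis linear_diff[OF linear(1)] scale(1))
    also have "\<dots> = (R0 (lmul ?s' (lmul J w)) - P0 (lmul J w)) - (R0 (lmul ?s (lmul J w)) - P0 (lmul J w))"
      by simp
    finally have "2 * \<bar>y\<bar> * norm (R0 w) \<le> c * norm (lmul J w) + c' * norm (lmul J w)"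
      using norm_triangle_le_diff[OF add_mono[OF bS bS']] by (metis abs_mult abs_numeral norm_scaleR)
    also have "\<dots> \<le> (\<bar>c\<bar> + \<bar>c'\<bar>) * norm (lmul J w)"
      by (simp add: distrib_right add_mono mult_right_mono)
    also have "\<dots> \<le> (\<bar>c\<bar> + \<bar>c'\<bar>) * (norm w * KJ)"
      by (intro mult_left_mono KJ) simp
    finally show ?thesis
      using \<open>y \<noteq> 0\<close> by (simp add: field_simps)
  qed
  then have R0: "bounded_linear R0"
    by (intro bounded_linear_intro[where K = "(\<bar>c\<bar> + \<bar>c'\<bar>) * KJ / (2 * \<bar>y\<bar>)"] add scale)
  obtain K1 where K1: "\<And>v. norm (R0 (lmul ?s' v)) \<le> norm v * K1"
    using bounded_linear.bounded[OF bounded_linear_compose[OF R0 bounded_linear_lmul_right]] by blast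
  have "norm (P0 v) \<le> norm v * (K1 + c)" for v
  proof -
    have "norm (P0 v) \<le> norm (R0 (lmul ?s' v)) + norm (R0 (lmul ?s' v) - P0 v)"
      using norm_triangle_ineq4[of "R0 (lmul ?s' v)" "R0 (lmul ?s' v) - P0 v"] by simp
    then show ?thesis
      using K1[of v] bS[of v] by (simp add: algebra_simps)
  qed
  then have P0: "bounded_linear P0"
    by (intro bounded_linear_intro[where K = "K1 + c"] add scale)
  have T_commute: "T (R0 v) = Some (R0 z)" "T (P0 v) = Some (P0 z)" if "T v = Some z" for v z
  proof -
    \<comment> \<open>The chain starting at \<open>P0 v\<close> continues once more because
      \<open>v\<close> lies in the domain of \<open>T\<close>, and \<open>Q\<close> maps
      \<open>P0 v\<close> to \<open>z\<close>. Hence \<open>R0 z = P0 v\<close>, which says that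
      \<open>R0\<close> commutes with \<open>T\<close> on the domain.\<close>
    have "T (v - ?m *\<^sub>R R0 v + (2 * x) *\<^sub>R P0 v) =
        Some (z - ?m *\<^sub>R P0 v + (2 * x) *\<^sub>R (v - ?m *\<^sub>R R0 v + (2 * x) *\<^sub>R P0 v))"
      by (intro closed_ops_add closed_ops_diff closed_ops_scaleR T TR0 TP0 that)
    note TTP0 = R0_eqI[OF TP0 this] P0_eqI[OF TP0 this]
    have "R0 z = P0 v" "P0 z = v - ?m *\<^sub>R R0 v + (2 * x) *\<^sub>R P0 v"
      by (rule TTP0; simp)+
    then show "T (R0 v) = Some (R0 z)" "T (P0 v) = Some (P0 z)"
      using TR0 TP0 by simp_all
  qed
  show ?thesis
  proof (rule that[of "Blinfun R0" "Blinfun P0"])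
    show "Blinfun R0 \<in> intrinsic_ops T" "Blinfun P0 \<in> intrinsic_ops T"
      using T_commute commute[OF bounded_linear.linear[OF blinfun.bounded_linear_right]] rmul
      by (auto simp: intrinsic_ops_def bounded_ops_def bounded_linear_Blinfun_apply R0 P0 blinfun_eqI)
  qed (simp_all add: S S' bounded_linear_Blinfun_apply R0 P0)
qed

section \<open>The functional calculus\<close>

lemma uminus_in_imag_units: "J \<in> imag_units \<Longrightarrow> - J \<in> imag_units"
  by (simp add: imag_units_def paravectors_def)

text \<open>The conjugate point has the same coordinates \<open>(x, y)\<close> with respect to the
  unit \<open>- J\<close>, so both values come from the same two real components.\<close>

lemma intrinsic_slice_pt:
  assumes f: "f \<in> intrinsic U" and xy: "(x, y) \<in> slice_coords U" and J: "J \<in> imag_units"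
  obtains a b where "f (slice_pt x J y) = slice_pt a J b" "f (slice_pt x J (- y)) = slice_pt a J (- b)"
proof -
  obtain f0 f1 where c: "slice_components U f f0 f1"
    and real: "\<forall>z\<in>slice_coords U. f0 z \<in> range cl_real \<and> f1 z \<in> range cl_real"
    using f by (auto simp: intrinsic_def)
  obtain a b where ab: "f0 (x, y) = cl_real a" "f1 (x, y) = cl_real b"
    using real xy by blast
  have f_eq: "f (slice_pt x I y) = slice_pt a I b" if "I \<in> imag_units" for I
    using c xy that by (auto simp: slice_components_def ab cl_mul_cl_real_right slice_pt_def)
  have uminus: "slice_pt u J (- w) = slice_pt u (- J) w" for u w
    by (simp add: slice_pt_def)
  show ?thesis
    using that f_eq[OF J] f_eq[OF uminus_in_imag_units[OF J]] by (simp add: uminus)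
qed

section \<open>The contour and its position relative to double sectors\<close>

lemma bisector_path_eq_slice_pt:
  "bisector_path \<phi> J \<sigma> t = slice_pt (\<sigma> * \<bar>t\<bar> * cos \<phi>) J (- (\<sigma> * t * sin \<phi>))"
  by (cases t "0 :: real" rule: linorder_cases)
    (simp_all add: bisector_path_def cl_exp_def scaleR_slice_pt)

text \<open>On each open half-line the path is linear in the parameter, since the absolute value is
  there multiplication by a fixed sign.\<close>

lemma vector_derivative_bisector_path:
  assumes "t \<noteq> 0"
  shows "vector_derivative (bisector_path \<phi> J \<sigma>) (at t)
    = slice_pt (\<sigma> * sgn t * cos \<phi>) J (- (\<sigma> * sin \<phi>))"
proof (rule vector_derivative_at)
  have lin: "slice_pt (\<sigma> * (e * u) * cos \<phi>) J (- (\<sigma> * u * sin \<phi>))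
      = u *\<^sub>R slice_pt (\<sigma> * e * cos \<phi>) J (- (\<sigma> * sin \<phi>))" for e u
    by (simp add: scaleR_slice_pt mult_ac)
  have "open {u. sgn u = sgn t}"
  proof (cases "t > 0")
    case True
    then have "{u. sgn u = sgn t} = {0<..}" by (auto simp: sgn_if split: if_splits)
    then show ?thesis by simp
  next
    case False
    then have "{u. sgn u = sgn t} = {..<0}" using assms by (auto simp: sgn_if split: if_splits)
    then show ?thesis by simp
  qed
  then show "(bisector_path \<phi> J \<sigma> has_vector_derivative
      slice_pt (\<sigma> * sgn t * cos \<phi>) J (- (\<sigma> * sin \<phi>))) (at t)"
  proof (rule has_vector_derivative_transform_within_open[rotated])
    show "((\<lambda>u. u *\<^sub>R slice_pt (\<sigma> * sgn t * cos \<phi>) J (- (\<sigma> * sin \<phi>))) has_vector_derivative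
        slice_pt (\<sigma> * sgn t * cos \<phi>) J (- (\<sigma> * sin \<phi>))) (at t)"
      by (auto intro!: derivative_eq_intros simp: has_vector_derivative_def)
    show "u *\<^sub>R slice_pt (\<sigma> * sgn t * cos \<phi>) J (- (\<sigma> * sin \<phi>)) = bisector_path \<phi> J \<sigma> u"
      if "u \<in> {u. sgn u = sgn t}" for u
      using that unfolding bisector_path_eq_slice_pt lin[symmetric] by (simp add: abs_sgn mult.commute)
  qed simp
qed

lemma slice_coords_double_sector:
  assumes "\<sigma> \<in> {1, - 1}" and "t \<noteq> 0" and "0 < \<phi>" "\<phi> < \<theta>"
  shows "(\<sigma> * \<bar>t\<bar> * cos \<phi>, - (\<sigma> * t * sin \<phi>)) \<in> slice_coords (double_sector \<theta>)"
proof -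
  \<comment> \<open>The argument of the point on the contour: the branch with sign -1 is turned by
    \<open>pi\<close>, into the second interval of \<open>arg_range\<close>.\<close>
  define \<eta> where "\<eta> = (if \<sigma> = 1 then 0 else pi) - sgn t * \<phi>"
  have "\<eta> \<in> arg_range \<theta>"
    using assms by (auto simp: \<eta>_def arg_range_def sgn_if)
  moreover have "slice_pt (\<sigma> * \<bar>t\<bar> * cos \<phi>) I (- (\<sigma> * t * sin \<phi>)) = \<bar>t\<bar> *\<^sub>R cl_exp I \<eta>" for I
    using assms by (cases "t > 0") (auto simp: \<eta>_def cl_exp_def scaleR_slice_pt)
  ultimately show ?thesis
    using \<open>t \<noteq> 0\<close> by (force simp: slice_coords_def double_sector_def)
qed

text \<open>The ratio of the absolute real part to the norm equals \<open>cos \<phi>\<close> on the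
  contour and is strictly larger inside the double sector.\<close>

lemma bisector_path_notin_double_sector:
  assumes "\<sigma> \<in> {1, - 1}" and "t \<noteq> 0" and \<phi>: "0 < \<phi>" "\<phi> < pi / 2" and J: "J \<in> imag_units"
  shows "bisector_path \<phi> J \<sigma> t \<notin> double_sector \<phi> \<union> {0}"
proof -
  let ?z = "bisector_path \<phi> J \<sigma> t"
  have "(norm ?z)\<^sup>2 = t\<^sup>2"
    using \<open>\<sigma> \<in> {1, - 1}\<close> unfolding bisector_path_eq_slice_pt norm_slice_pt[OF J]
    by (auto simp: power_mult_distrib simp flip: distrib_left)
  then have norm_z: "norm ?z = \<bar>t\<bar>"
    using real_sqrt_unique[of "norm ?z" "t\<^sup>2"] by simp
  have re_z: "\<bar>?z $ {}\<bar> = \<bar>t\<bar> * cos \<phi>"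
    using assms cos_gt_zero[of \<phi>] unfolding bisector_path_eq_slice_pt slice_pt_nth_empty[OF J]
    by (auto simp: abs_mult)
  have "?z \<noteq> r *\<^sub>R cl_exp I \<eta>" if "r > 0" "I \<in> imag_units" "\<eta> \<in> arg_range \<phi>" for r I \<eta>
  proof
    assume z: "?z = r *\<^sub>R cl_exp I \<eta>"
    have "(norm (cl_exp I \<eta>))\<^sup>2 = 1"
      unfolding cl_exp_def norm_slice_pt[OF that(2)] by simp
    then have "norm (cl_exp I \<eta>) = 1"
      by (simp add: power2_eq_1_iff) (smt (verit) norm_ge_zero)
    then have "\<bar>t\<bar> = r"
      using norm_z that(1) by (simp add: z)
    moreover have "\<bar>?z $ {}\<bar> = r * \<bar>cos \<eta>\<bar>"
      using that by (simp add: z cl_exp_def slice_pt_nth_empty abs_mult)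
    ultimately have "\<bar>cos \<eta>\<bar> = cos \<phi>"
      using re_z that(1) by simp
    moreover have "cos \<phi> < \<bar>cos \<eta>\<bar>"
    proof -
      have *: "cos \<phi> < cos \<bar>u\<bar>" if "\<bar>u\<bar> < \<phi>" for u
        using that \<phi> by (intro cos_monotone_0_pi) auto
      show ?thesis
        using that(3) *[of \<eta>] *[of "\<eta> - pi"] unfolding arg_range_def
        by (auto simp: cos_diff abs_less_iff)
    qed
    ultimately show False by simp
  qed
  then show ?thesis
    using norm_z \<open>t \<noteq> 0\<close> unfolding double_sector_def by fastforce
qed

section \<open>The integrand and its integral\<close>

lemma omega_integrand_apply:
  fixes R P :: "('v::real_normed_vector, 'n::{finite,linorder}) cl_module \<Rightarrow>\<^sub>L ('v, 'n) cl_module"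
  assumes "\<And>v. S_L_inv (bisector_path \<phi> J \<sigma> t) T v = Some (R (lmul s v) - P v)"
    and "cl_mul (cl_mul (vector_derivative (bisector_path \<phi> J \<sigma>) (at t)) (- J)) (f (bisector_path \<phi> J \<sigma> t)) = c"
  shows "omega_integrand \<phi> J T f \<sigma> t v = R (lmul s (lmul c v)) - P (lmul c v)"
proof -
  \<comment> \<open>\<open>Blinfun\<close> returns the given function only if that function is
    bounded linear.\<close>
  have "bounded_linear (\<lambda>v. R (lmul s (lmul c v)) - P (lmul c v))"
    by (rule bounded_linear_sub[OF
          bounded_linear_compose[OF blinfun.bounded_linear_right
            bounded_linear_compose[OF bounded_linear_lmul_right bounded_linear_lmul_right]]
          bounded_linear_compose[OF blinfun.bounded_linear_right bounded_linear_lmul_right]])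
  then show ?thesis
    unfolding omega_integrand_def Let_def assms(2)
    by (simp add: map_comp_def assms(1) bounded_linear_Blinfun_apply)
qed

text \<open>
  The points \<open>\<gamma>(t)\<close> and \<open>\<gamma>(-t)\<close> are conjugate and \<open>f\<close> is intrinsic, so the non-real parts of
  the two Clifford coefficients cancel; what remains are real multiples of \<open>Q\<^sub>s[T]\<^sup>-\<^sup>1\<close> and
  \<open>T Q\<^sub>s[T]\<^sup>-\<^sup>1\<close>.
\<close>

lemma omega_integrand_even_part:
  fixes T :: "('v::real_normed_vector, 'n::{finite,linorder}) cl_op"
  assumes T: "bisectorial \<omega> T" and f: "f \<in> intrinsic (double_sector \<theta>)"
    and ang: "0 < \<omega>" "\<omega> < \<phi>" "\<phi> < \<theta>" "\<theta> < pi / 2"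
    and J: "J \<in> imag_units" and \<sigma>: "\<sigma> \<in> {1, - 1}" and "t \<noteq> 0"
  shows "omega_integrand \<phi> J T f \<sigma> t + omega_integrand \<phi> J T f \<sigma> (- t) \<in> intrinsic_ops T"
proof -
  define x y where "x = \<sigma> * \<bar>t\<bar> * cos \<phi>" and "y = - (\<sigma> * t * sin \<phi>)"
  define \<alpha> \<beta> where "\<alpha> = \<sigma> * sgn t * cos \<phi>" and "\<beta> = - (\<sigma> * sin \<phi>)"
  have closed: "T \<in> closed_ops"
    using T by (simp add: bisectorial_def)
  have path: "bisector_path \<phi> J \<sigma> t = slice_pt x J y" "bisector_path \<phi> J \<sigma> (- t) = slice_pt x J (- y)"
    by (simp_all add: bisector_path_eq_slice_pt x_def y_def)
  have deriv: "vector_derivative (bisector_path \<phi> J \<sigma>) (at t) = slice_pt \<alpha> J \<beta>"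
    "vector_derivative (bisector_path \<phi> J \<sigma>) (at (- t)) = slice_pt (- \<alpha>) J \<beta>"
    using \<open>t \<noteq> 0\<close> by (simp_all add: vector_derivative_bisector_path \<alpha>_def \<beta>_def sgn_minus)
  have "- t \<noteq> 0"
    using \<open>t \<noteq> 0\<close> by simp
  have "sin \<phi> > 0"
    using ang by (intro sin_gt_zero) auto
  then have "y \<noteq> 0"
    using \<sigma> \<open>t \<noteq> 0\<close> by (auto simp: y_def)
  \<comment> \<open>The resolvent estimate is taken at the contour angle itself, which is admissible
    because the contour avoids the open double sector of this angle.\<close>
  obtain C where C: "\<And>s. s \<in> paravectors - (double_sector \<phi> \<union> {0}) \<Longrightarrow> op_norm_le (S_L_inv s T) (C / norm s)"
    using T ang unfolding bisectorial_def by force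
  have bound: "op_norm_le (S_L_inv (bisector_path \<phi> J \<sigma> u) T) (C / norm (bisector_path \<phi> J \<sigma> u))"
    if "u \<noteq> 0" for u
    using bisector_path_notin_double_sector[OF \<sigma> that _ _ J, of \<phi>] ang slice_pt_in_paravectors[OF J]
    by (intro C) (auto simp: bisector_path_eq_slice_pt)
  obtain R P where RP: "R \<in> intrinsic_ops T" "P \<in> intrinsic_ops T"
    "\<And>v. S_L_inv (slice_pt x J y) T v = Some (R (lmul (slice_pt x J (- y)) v) - P v)"
    "\<And>v. S_L_inv (slice_pt x J (- y)) T v = Some (R (lmul (slice_pt x J y) v) - P v)"
    by (rule resolvent_in_intrinsic_ops[OF closed J \<open>y \<noteq> 0\<close>
          bound[OF \<open>t \<noteq> 0\<close>, unfolded path] bound[OF \<open>- t \<noteq> 0\<close>, unfolded path]])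
      (rule that)
  have "(x, y) \<in> slice_coords (double_sector \<theta>)"
    unfolding x_def y_def using \<sigma> \<open>t \<noteq> 0\<close> ang by (intro slice_coords_double_sector) auto
  then obtain a b where ab: "f (slice_pt x J y) = slice_pt a J b" "f (slice_pt x J (- y)) = slice_pt a J (- b)"
    using intrinsic_slice_pt[OF f _ J] by blast
  \<comment> \<open>These are the real and imaginary parts of the derivative times
    \<open>- J\<close> times the value of \<open>f\<close>. Passing to \<open>- t\<close> changes
    the signs of \<open>\<alpha>\<close> and \<open>b\<close>, which fixes \<open>p\<close> and
    negates \<open>q\<close>.\<close>
  define p q where "p = \<beta> * a + \<alpha> * b" and "q = \<beta> * b - \<alpha> * a"
  have "cl_mul (cl_mul (slice_pt \<alpha> J \<beta>) (- J)) (slice_pt a J b) = slice_pt p J q"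
    unfolding p_def q_def uminus_eq_slice_pt cl_mul_slice_pt[OF J] by (simp add: algebra_simps)
  then have h: "omega_integrand \<phi> J T f \<sigma> t v =
      R (lmul (slice_pt x J (- y)) (lmul (slice_pt p J q) v)) - P (lmul (slice_pt p J q) v)" for v
    by (intro omega_integrand_apply) (simp_all add: path deriv ab RP(3))
  have "cl_mul (cl_mul (slice_pt (- \<alpha>) J \<beta>) (- J)) (slice_pt a J (- b)) = slice_pt p J (- q)"
    unfolding p_def q_def uminus_eq_slice_pt cl_mul_slice_pt[OF J] by (simp add: algebra_simps)
  then have h': "omega_integrand \<phi> J T f \<sigma> (- t) v =
      R (lmul (slice_pt x J y) (lmul (slice_pt p J (- q)) v)) - P (lmul (slice_pt p J (- q)) v)" for v
    by (intro omega_integrand_apply) (simp_all add: path deriv ab RP(4))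
  have "omega_integrand \<phi> J T f \<sigma> t + omega_integrand \<phi> J T f \<sigma> (- t)
      = (2 * (x * p + y * q)) *\<^sub>R R - (2 * p) *\<^sub>R P"
  proof (rule blinfun_eqI)
    fix v :: "('v, 'n) cl_module"
    have "cl_mul (slice_pt x J (- y)) (slice_pt p J q) = slice_pt (x * p + y * q) J (x * q - y * p)"
      "cl_mul (slice_pt x J y) (slice_pt p J (- q)) = slice_pt (x * p + y * q) J (- (x * q - y * p))"
      by (simp_all add: cl_mul_slice_pt[OF J])
    then have 1: "lmul (slice_pt x J (- y)) (lmul (slice_pt p J q) v) + lmul (slice_pt x J y) (lmul (slice_pt p J (- q)) v)
        = (2 * (x * p + y * q)) *\<^sub>R v"
      by (simp only: lmul_assoc[symmetric] lmul_slice_pt_add_conj)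
    have "(omega_integrand \<phi> J T f \<sigma> t + omega_integrand \<phi> J T f \<sigma> (- t)) v
        = R (lmul (slice_pt x J (- y)) (lmul (slice_pt p J q) v) + lmul (slice_pt x J y) (lmul (slice_pt p J (- q)) v))
          - P (lmul (slice_pt p J q) v + lmul (slice_pt p J (- q)) v)"
      by (simp add: h h' blinfun.add_left blinfun.add_right)
    also have "\<dots> = ((2 * (x * p + y * q)) *\<^sub>R R - (2 * p) *\<^sub>R P) v"
      unfolding 1 lmul_slice_pt_add_conj
      by (simp only: blinfun.diff_left blinfun.scaleR_left blinfun.scaleR_right)
    finally show "(omega_integrand \<phi> J T f \<sigma> t + omega_integrand \<phi> J T f \<sigma> (- t)) v
        = ((2 * (x * p + y * q)) *\<^sub>R R - (2 * p) *\<^sub>R P) v" .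
  qed
  then show ?thesis
    using subspace_diff subspace_scale subspace_intrinsic_ops[OF closed] RP(1,2) by metis
qed

lemma omega_calculus_in_intrinsic_ops:
  assumes T: "bisectorial \<omega> T" and f: "f \<in> intrinsic (double_sector \<theta>)"
    and ang: "0 < \<omega>" "\<omega> < \<phi>" "\<phi> < \<theta>" "\<theta> < pi / 2"
    and J: "J \<in> imag_units"
  shows "omega_calculus \<phi> J T f \<in> intrinsic_ops T"
proof -
  have closed: "T \<in> closed_ops"
    using T by (simp add: bisectorial_def)
  have "integral UNIV (omega_integrand \<phi> J T f \<sigma>) \<in> intrinsic_ops T" if "\<sigma> \<in> {1, - 1}" for \<sigma>
    by (rule integral_in_closed_subspace_reflect[OF subspace_intrinsic_ops[OF closed] closed_intrinsic_ops[OF closed]])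
      (rule omega_integrand_even_part[OF T f ang J that])
  then show ?thesis
    unfolding omega_calculus_def
    by (intro subspace_scale subspace_sum subspace_intrinsic_ops closed)
qed

theorem corollary3p18:
  fixes T :: "('v::banach, 'n::{finite,linorder}) cl_op"
    and \<omega> \<theta> :: real
    and g :: "'n clifford \<Rightarrow> 'n clifford"
    and \<phi> :: real and J :: "'n clifford"
  assumes "0 < \<omega>" and "\<omega> < pi / 2" and "bisectorial \<omega> T"
    and "\<omega> < \<theta>" and "\<theta> < pi / 2" and "g \<in> intrinsic0 \<theta>"
    and "\<omega> < \<phi>" and "\<phi> < \<theta>" and "J \<in> imag_units"
  shows "(\<forall>B\<in>bounded_ops. total_op (blinfun_apply B) \<circ>\<^sub>m T \<subseteq>\<^sub>m T \<circ>\<^sub>m total_op (blinfun_apply B) \<longrightarrow>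
            B o\<^sub>L omega_calculus \<phi> J T g = omega_calculus \<phi> J T g o\<^sub>L B)
    \<and> (\<forall>p :: real poly. p \<noteq> 0 \<longrightarrow>
          total_op (blinfun_apply (omega_calculus \<phi> J T g)) \<circ>\<^sub>m poly_op p T
            \<subseteq>\<^sub>m poly_op p T \<circ>\<^sub>m total_op (blinfun_apply (omega_calculus \<phi> J T g)))
    \<and> (\<forall>f \<in> intrinsic0 \<theta>. \<forall>\<psi> \<in> {\<omega> <..< \<theta>}. \<forall>I \<in> imag_units.
          omega_calculus \<phi> J T g o\<^sub>L omega_calculus \<psi> I T f
            = omega_calculus \<psi> I T f o\<^sub>L omega_calculus \<phi> J T g)"
proof -
  \<comment> \<open>Membership is recorded for an arbitrary contour, since \<open>g\<close> and
    \<open>f\<close> may be evaluated along different ones.\<close>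
  have mem: "omega_calculus \<psi> I T f \<in> intrinsic_ops T"
    if "f \<in> intrinsic0 \<theta>" "\<omega> < \<psi>" "\<psi> < \<theta>" "I \<in> imag_units" for f \<psi> I
    using omega_calculus_in_intrinsic_ops[of \<omega> T f \<theta> \<psi> I] assms that
    by (simp add: intrinsic0_def)
  let ?G = "omega_calculus \<phi> J T g"
  have G: "?G \<in> intrinsic_ops T"
    by (rule mem) (use assms in auto)
  have G_T: "T (?G v) = Some (?G x)" if "T v = Some x" for v x
    using G that by (simp add: intrinsic_ops_def)
  have G_B: "B o\<^sub>L ?G = ?G o\<^sub>L B"
    if "B \<in> bounded_ops" "\<And>v x. T v = Some x \<Longrightarrow> T (blinfun_apply B v) = Some (B x)" for B
    using G that by (simp add: intrinsic_ops_def)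
  have G_poly: "poly_op p T (?G v) = Some (?G x)" if "poly_op p T v = Some x" for p v x
    by (rule poly_op_commute[where K = "blinfun_apply ?G"])
      (use G_T that in \<open>auto intro: bounded_linear.linear blinfun.bounded_linear_right\<close>)
  have "?G o\<^sub>L F = F o\<^sub>L ?G" if "F \<in> intrinsic_ops T" for F
    using G_B[of F] that by (simp add: intrinsic_ops_def)
  then show ?thesis
    unfolding total_op_comp_map_le_iff
    using G_B G_poly mem unfolding map_le_def by (auto simp: map_comp_def split: option.splits)
qed

end
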